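(* Let $M=(S,T,I,L)$ be a Kripke structure and $\psi$ an LTL formula in positive normal form. Then $M$ has an initialised infinite path $\pi$ such that $\pi\models\psi$ if and only if there exists $k\in\mathbb{N}$ such that the eventuality encoding $[\![M,\psi,k]\!]$ is satisfiable. In particular, if $\pi$ is an initialised infinite path of $M$ with $\pi\models_k\psi$, then $[\![M,\psi,k]\!]$ is satisfiable.
   Context: Kripke structures: $AP$ is a set of atomic propositions; $M=(S,T,I,L)$ has a finite set of states $S$ (valuations of finitely many Boolean state variables), a total transition relation $T\subseteq S\times S$, initial states $I\subseteq S$ and labelling $L:S\to 2^{AP}$. An infinite path $\pi=s_0s_1\ldots$ is initialised if $s_0\in I$; $\pi^i$ denotes $\pi$ with evaluation position $i$. LTL in positive normal form: formulas built from $p,\neg p$ ($p\in AP$) with $\wedge,\vee,\mathbf{X},\mathbf{U},\mathbf{R}$, standard semantics: $\pi^i\models p$ iff $p\in L(s_i)$; $\pi^i\models\mathbf{X}\psi_1$ iff $\pi^{i+1}\models\psi_1$; $\pi^i\models\psi_1\mathbf{U}\psi_2$ iff $\exists j\ge i$: $\pi^j\models\psi_2$ and $\pi^n\models\psi_1$ for $i\le n<j$; $\pi^i\models\psi_1\mathbf{R}\psi_2$ iff for all $j\ge i$: $\pi^j\models\psi_2$ or $\pi^n\models\psi_1$ for some $i\le n<j$. $\mathit{cl}(\psi)$ is the set of subformulas of $\psi$. Bounded semantics: $\pi$ is a $(k,l)$-loop if $\pi=(s_0\ldots s_{l-1})(s_l\ldots s_k)^\omega$ with $0<l\le k$ and $s_{l-1}=s_k$.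 $\pi\models_k\psi$ iff (a) $\pi$ is a $(k,l)$-loop for some $0<l\le k$ and $\pi^0\models\psi$, or (b) $\pi^0\models^{nl}_k\psi$, where $\models^{nl}_k$ agrees with $\models$ on $p,\neg p,\wedge,\vee$ and: $\pi^i\models^{nl}_k\mathbf{X}\psi_1$ iff $i<k$ and $\pi^{i+1}\models^{nl}_k\psi_1$; $\pi^i\models^{nl}_k\psi_1\mathbf{U}\psi_2$ iff $\exists i\le j\le k$: $\pi^j\models^{nl}_k\psi_2$ and $\pi^n\models^{nl}_k\psi_1$ for all $i\le n<j$; $\pi^i\models^{nl}_k\psi_1\mathbf{R}\psi_2$ iff $\exists i\le j\le k$: $\pi^j\models^{nl}_k\psi_1$ and $\pi^n\models^{nl}_k\psi_2$ for all $i\le n\le j$. Encoding. Propositional copies $s_0,\dots,s_k$ of state variables. Model constraints $[\![M]\!]_k=I(s_0)\wedge\bigwedge_{i=1}^kT(s_{i-1},s_i)$. Loop constraints (fresh $l_0..l_k$, $\mathit{InLoop}_0..\mathit{InLoop}_k$, $\mathit{LoopExists}$): $l_0\Leftrightarrow\bot$, $\mathit{InLoop}_0\Leftrightarrow\bot$; for $1\le i\le k$: $l_i\Rightarrow(s_{i-1}=s_k)$, $\mathit{InLoop}_i\Leftrightarrow\mathit{InLoop}_{i-1}\vee l_i$, $\mathit{InLoop}_{i-1}\Rightarrow\neg l_i$; $\mathit{LoopExists}\Leftrightarrow\mathit{InLoop}_k$. Fresh formula variables $[\![\varphi]\!]_i$ for every $\varphi\in\mathit{cl}(\psi)$ and $0\le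 i\le k+1$, constrained by: for $0\le i\le k$, $[\![p]\!]_i\Leftrightarrow(p\in L(s_i))$ and $[\![\neg p]\!]_i\Leftrightarrow(p\notin L(s_i))$ (as propositional formulas over $s_i$); $[\![\psi_1\wedge\psi_2]\!]_i\Leftrightarrow[\![\psi_1]\!]_i\wedge[\![\psi_2]\!]_i$ and $[\![\psi_1\vee\psi_2]\!]_i\Leftrightarrow[\![\psi_1]\!]_i\vee[\![\psi_2]\!]_i$; for $0\le i\le k$: $[\![\mathbf{X}\psi_1]\!]_i\Leftrightarrow[\![\psi_1]\!]_{i+1}$, $[\![\psi_1\mathbf{U}\psi_2]\!]_i\Leftrightarrow[\![\psi_2]\!]_i\vee([\![\psi_1]\!]_i\wedge[\![\psi_1\mathbf{U}\psi_2]\!]_{i+1})$, $[\![\psi_1\mathbf{R}\psi_2]\!]_i\Leftrightarrow[\![\psi_2]\!]_i\wedge([\![\psi_1]\!]_i\vee[\![\psi_1\mathbf{R}\psi_2]\!]_{i+1})$. Last-state constraints, for each $\varphi\in\mathit{cl}(\psi)$: $\neg\mathit{LoopExists}\Rightarrow([\![\varphi]\!]_{k+1}\Leftrightarrow\bot)$ and for $1\le i\le k$: $l_i\Rightarrow([\![\varphi]\!]_{k+1}\Leftrightarrow[\![\varphi]\!]_i)$. Auxiliary eventuality constraints: for each subformula $\psi_1\mathbf{U}\psi_2$, fresh variables $\langle\!\langle\mathbf{F}\psi_2\rangle\!\rangle_i$ ($0\le i\le k$) with $\langle\!\langle\mathbf{F}\psi_2\rangle\!\rangle_0\Leftrightarrow\bot$,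 $\langle\!\langle\mathbf{F}\psi_2\rangle\!\rangle_i\Leftrightarrow\langle\!\langle\mathbf{F}\psi_2\rangle\!\rangle_{i-1}\vee(\mathit{InLoop}_i\wedge[\![\psi_2]\!]_i)$ for $1\le i\le k$, and $\mathit{LoopExists}\Rightarrow([\![\psi_1\mathbf{U}\psi_2]\!]_k\Rightarrow\langle\!\langle\mathbf{F}\psi_2\rangle\!\rangle_k)$; for each subformula $\psi_1\mathbf{R}\psi_2$, fresh $\langle\!\langle\mathbf{G}\psi_2\rangle\!\rangle_i$ with $\langle\!\langle\mathbf{G}\psi_2\rangle\!\rangle_0\Leftrightarrow\top$, $\langle\!\langle\mathbf{G}\psi_2\rangle\!\rangle_i\Leftrightarrow\langle\!\langle\mathbf{G}\psi_2\rangle\!\rangle_{i-1}\wedge(\neg\mathit{InLoop}_i\vee[\![\psi_2]\!]_i)$ for $1\le i\le k$, and $\mathit{LoopExists}\Rightarrow(\langle\!\langle\mathbf{G}\psi_2\rangle\!\rangle_k\Rightarrow[\![\psi_1\mathbf{R}\psi_2]\!]_k)$. The eventuality encoding $[\![M,\psi,k]\!]$ is the conjunction of the model constraints, loop constraints, last-state constraints, the formula-variable and auxiliary constraints, and $[\![\psi]\!]_0$. *)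

theory Defs
  imports Main "HOL-Library.Omega_Words_Fun"
begin

section \<open>Propositional logic\<close>

text \<open>An interpretation is given by the set of atoms that it makes true.\<close>

datatype (patoms: 'x) pform =
    PTrue | PFalse | Atom 'x | PNot "'x pform"
  | PAnd "'x pform" "'x pform" | POr "'x pform" "'x pform"
  | PImp "'x pform" "'x pform" | PIff "'x pform" "'x pform"

primrec pholds :: "'x set \<Rightarrow> 'x pform \<Rightarrow> bool" where
  "pholds \<nu> PTrue \<longleftrightarrow> True"
| "pholds \<nu> PFalse \<longleftrightarrow> False"
| "pholds \<nu> (Atom x) \<longleftrightarrow> x \<in> \<nu>"
| "pholds \<nu> (PNot f) \<longleftrightarrow> \<not> pholds \<nu> f"
| "pholds \<nu> (PAnd f g) \<longleftrightarrow> pholds \<nu> f \<and> pholds \<nu> g"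
| "pholds \<nu> (POr f g) \<longleftrightarrow> pholds \<nu> f \<or> pholds \<nu> g"
| "pholds \<nu> (PImp f g) \<longleftrightarrow> (pholds \<nu> f \<longrightarrow> pholds \<nu> g)"
| "pholds \<nu> (PIff f g) \<longleftrightarrow> (pholds \<nu> f \<longleftrightarrow> pholds \<nu> g)"

text \<open>A set of formulas stands for its conjunction.\<close>

definition satisfiable :: "'x pform set \<Rightarrow> bool" where
  "satisfiable F \<longleftrightarrow> (\<exists>\<nu>. \<forall>f\<in>F. pholds \<nu> f)"

section \<open>Kripke structures\<close>

text \<open>A state is a valuation of the finitely many state variables \<open>vars\<close>, represented by the
  set of variables that it makes true.  The type \<open>'a\<close> is the set of atomic propositions.\<close>

record ('v, 'a) kripke =
  vars :: "'v set"
  states :: "'v set set"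
  transitions :: "('v set \<times> 'v set) set"
  initial :: "'v set set"
  label :: "'v set \<Rightarrow> 'a set"

definition kripke :: "('v, 'a) kripke \<Rightarrow> bool" where
  "kripke M \<longleftrightarrow>
     finite (vars M) \<and> states M \<subseteq> Pow (vars M) \<and>
     transitions M \<subseteq> states M \<times> states M \<and> (\<forall>s\<in>states M. \<exists>t. (s, t) \<in> transitions M) \<and>
     initial M \<subseteq> states M"

definition initialised_path :: "('v, 'a) kripke \<Rightarrow> 'v set word \<Rightarrow> bool" where
  "initialised_path M \<pi> \<longleftrightarrow> \<pi> 0 \<in> initial M \<and> (\<forall>i. (\<pi> i, \<pi> (Suc i)) \<in> transitions M)"

section \<open>LTL in positive normal form\<close>

datatype 'a ltl =
    Prop 'a | NProp 'a
  | And "'a ltl" "'a ltl" | Or "'a ltl" "'a ltl"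
  | Next "'a ltl" | Until "'a ltl" "'a ltl" | Release "'a ltl" "'a ltl"

primrec cl :: "'a ltl \<Rightarrow> 'a ltl set" where
  "cl (Prop p) = {Prop p}"
| "cl (NProp p) = {NProp p}"
| "cl (And f g) = insert (And f g) (cl f \<union> cl g)"
| "cl (Or f g) = insert (Or f g) (cl f \<union> cl g)"
| "cl (Next f) = insert (Next f) (cl f)"
| "cl (Until f g) = insert (Until f g) (cl f \<union> cl g)"
| "cl (Release f g) = insert (Release f g) (cl f \<union> cl g)"

primrec sat :: "('s \<Rightarrow> 'a set) \<Rightarrow> 's word \<Rightarrow> nat \<Rightarrow> 'a ltl \<Rightarrow> bool" where
  "sat L \<pi> i (Prop p) \<longleftrightarrow> p \<in> L (\<pi> i)"
| "sat L \<pi> i (NProp p) \<longleftrightarrow> p \<notin> L (\<pi> i)"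
| "sat L \<pi> i (And f g) \<longleftrightarrow> sat L \<pi> i f \<and> sat L \<pi> i g"
| "sat L \<pi> i (Or f g) \<longleftrightarrow> sat L \<pi> i f \<or> sat L \<pi> i g"
| "sat L \<pi> i (Next f) \<longleftrightarrow> sat L \<pi> (Suc i) f"
| "sat L \<pi> i (Until f g) \<longleftrightarrow> (\<exists>j\<ge>i. sat L \<pi> j g \<and> (\<forall>n. i \<le> n \<and> n < j \<longrightarrow> sat L \<pi> n f))"
| "sat L \<pi> i (Release f g) \<longleftrightarrow> (\<forall>j\<ge>i. sat L \<pi> j g \<or> (\<exists>n. i \<le> n \<and> n < j \<and> sat L \<pi> n f))"

section \<open>Bounded semantics\<close>

definition kl_loop :: "'s word \<Rightarrow> nat \<Rightarrow> nat \<Rightarrow> bool" where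
  "kl_loop \<pi> k l \<longleftrightarrow>
     0 < l \<and> l \<le> k \<and> \<pi> = (\<pi> [0 \<rightarrow> l]) \<frown> (\<pi> [l \<rightarrow> Suc k])\<^sup>\<omega> \<and> \<pi> (l - 1) = \<pi> k"

primrec sat_nl :: "('s \<Rightarrow> 'a set) \<Rightarrow> 's word \<Rightarrow> nat \<Rightarrow> nat \<Rightarrow> 'a ltl \<Rightarrow> bool" where
  "sat_nl L \<pi> k i (Prop p) \<longleftrightarrow> p \<in> L (\<pi> i)"
| "sat_nl L \<pi> k i (NProp p) \<longleftrightarrow> p \<notin> L (\<pi> i)"
| "sat_nl L \<pi> k i (And f g) \<longleftrightarrow> sat_nl L \<pi> k i f \<and> sat_nl L \<pi> k i g"
| "sat_nl L \<pi> k i (Or f g) \<longleftrightarrow> sat_nl L \<pi> k i f \<or> sat_nl L \<pi> k i g"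
| "sat_nl L \<pi> k i (Next f) \<longleftrightarrow> i < k \<and> sat_nl L \<pi> k (Suc i) f"
| "sat_nl L \<pi> k i (Until f g) \<longleftrightarrow>
     (\<exists>j. i \<le> j \<and> j \<le> k \<and> sat_nl L \<pi> k j g \<and> (\<forall>n. i \<le> n \<and> n < j \<longrightarrow> sat_nl L \<pi> k n f))"
| "sat_nl L \<pi> k i (Release f g) \<longleftrightarrow>
     (\<exists>j. i \<le> j \<and> j \<le> k \<and> sat_nl L \<pi> k j f \<and> (\<forall>n. i \<le> n \<and> n \<le> j \<longrightarrow> sat_nl L \<pi> k n g))"

definition bounded_sat :: "('s \<Rightarrow> 'a set) \<Rightarrow> 's word \<Rightarrow> nat \<Rightarrow> 'a ltl \<Rightarrow> bool" where
  "bounded_sat L \<pi> k \<psi> \<longleftrightarrow>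
     (\<exists>l. kl_loop \<pi> k l) \<and> sat L \<pi> 0 \<psi> \<or> sat_nl L \<pi> k 0 \<psi>"

section \<open>Symbolic representations\<close>

text \<open>The encoding uses propositional formulas over the state variables for \<open>I\<close>, \<open>T\<close> and
  \<open>p \<in> L(s)\<close>.  Which formulas are chosen is left open; they only have to denote
  the components of the structure.  In \<open>trans_fm\<close>, \<open>Inl v\<close> is the current and \<open>Inr v\<close> the next
  value of \<open>v\<close>, so that \<open>s <+> t\<close> is the interpretation given by the pair \<open>(s, t)\<close>.\<close>

record ('v, 'a) symbolic =
  init_fm :: "'v pform"
  trans_fm :: "('v + 'v) pform"
  label_fm :: "'a \<Rightarrow> 'v pform"

definition represents :: "('v, 'a) symbolic \<Rightarrow> ('v, 'a) kripke \<Rightarrow> bool" where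
  "represents R M \<longleftrightarrow>
     patoms (init_fm R) \<subseteq> vars M \<and>
     patoms (trans_fm R) \<subseteq> vars M <+> vars M \<and>
     (\<forall>p. patoms (label_fm R p) \<subseteq> vars M) \<and>
     (\<forall>s \<subseteq> vars M. pholds s (init_fm R) \<longleftrightarrow> s \<in> initial M) \<and>
     (\<forall>s \<subseteq> vars M. \<forall>t \<subseteq> vars M. pholds (s <+> t) (trans_fm R) \<longleftrightarrow> (s, t) \<in> transitions M) \<and>
     (\<forall>s \<in> states M. \<forall>p. pholds s (label_fm R p) \<longleftrightarrow> p \<in> label M s)"

section \<open>The eventuality encoding\<close>

text \<open>\<open>Copy v i\<close> is the copy of the state variable \<open>v\<close> in \<open>s\<^sub>i\<close>, and \<open>Fm \<phi> i\<close>, \<open>AuxF \<phi> i\<close>,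
  \<open>AuxG \<phi> i\<close> are the variables for \<open>\<phi>\<close>, \<open>F \<phi>\<close> and \<open>G \<phi>\<close> at position \<open>i\<close>.\<close>

datatype ('v, 'a) evar =
    Copy 'v nat
  | Lsel nat | InLoop nat | LoopExists
  | Fm "'a ltl" nat | AuxF "'a ltl" nat | AuxG "'a ltl" nat

definition copy_at :: "nat \<Rightarrow> 'v pform \<Rightarrow> ('v, 'a) evar pform" where
  "copy_at i f = map_pform (\<lambda>v. Copy v i) f"

definition between :: "nat \<Rightarrow> nat \<Rightarrow> ('v + 'v) pform \<Rightarrow> ('v, 'a) evar pform" where
  "between i j f = map_pform (case_sum (\<lambda>v. Copy v i) (\<lambda>v. Copy v j)) f"

definition model_constraints ::
    "('v, 'a) symbolic \<Rightarrow> nat \<Rightarrow> ('v, 'a) evar pform set" where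
  "model_constraints R k =
     insert (copy_at 0 (init_fm R)) {between (i - 1) i (trans_fm R) | i. 1 \<le> i \<and> i \<le> k}"

text \<open>\<open>s\<^sub>i\<^sub>-\<^sub>1 = s\<^sub>k\<close> is the conjunction of the equivalences of the corresponding variable copies;
  the implication from \<open>l\<^sub>i\<close> is distributed over this conjunction.\<close>

definition loop_constraints ::
    "('v, 'a) kripke \<Rightarrow> nat \<Rightarrow> ('v, 'a) evar pform set" where
  "loop_constraints M k =
     {PIff (Atom (Lsel 0)) PFalse, PIff (Atom (InLoop 0)) PFalse,
      PIff (Atom LoopExists) (Atom (InLoop k))} \<union>
     {PImp (Atom (Lsel i)) (PIff (Atom (Copy v (i - 1))) (Atom (Copy v k))) | i v.
        1 \<le> i \<and> i \<le> k \<and> v \<in> vars M} \<union>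
     {PIff (Atom (InLoop i)) (POr (Atom (InLoop (i - 1))) (Atom (Lsel i))) | i. 1 \<le> i \<and> i \<le> k} \<union>
     {PImp (Atom (InLoop (i - 1))) (PNot (Atom (Lsel i))) | i. 1 \<le> i \<and> i \<le> k}"

text \<open>The formula to which the variable \<open>Fm \<phi> i\<close> is equivalent for \<open>i \<le> k\<close>.\<close>

fun unfold_fm :: "('v, 'a) symbolic \<Rightarrow> nat \<Rightarrow> 'a ltl \<Rightarrow> ('v, 'a) evar pform" where
  "unfold_fm R i (Prop p) = copy_at i (label_fm R p)"
| "unfold_fm R i (NProp p) = PNot (copy_at i (label_fm R p))"
| "unfold_fm R i (And f g) = PAnd (Atom (Fm f i)) (Atom (Fm g i))"
| "unfold_fm R i (Or f g) = POr (Atom (Fm f i)) (Atom (Fm g i))"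
| "unfold_fm R i (Next f) = Atom (Fm f (i + 1))"
| "unfold_fm R i (Until f g) =
     POr (Atom (Fm g i)) (PAnd (Atom (Fm f i)) (Atom (Fm (Until f g) (i + 1))))"
| "unfold_fm R i (Release f g) =
     PAnd (Atom (Fm g i)) (POr (Atom (Fm f i)) (Atom (Fm (Release f g) (i + 1))))"

definition formula_constraints ::
    "('v, 'a) symbolic \<Rightarrow> 'a ltl \<Rightarrow> nat \<Rightarrow> ('v, 'a) evar pform set" where
  "formula_constraints R \<psi> k =
     {PIff (Atom (Fm \<phi> i)) (unfold_fm R i \<phi>) | \<phi> i. \<phi> \<in> cl \<psi> \<and> i \<le> k}"

definition last_state_constraints :: "'a ltl \<Rightarrow> nat \<Rightarrow> ('v, 'a) evar pform set" where
  "last_state_constraints \<psi> k =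
     {PImp (PNot (Atom LoopExists)) (PIff (Atom (Fm \<phi> (k + 1))) PFalse) | \<phi>. \<phi> \<in> cl \<psi>} \<union>
     {PImp (Atom (Lsel i)) (PIff (Atom (Fm \<phi> (k + 1))) (Atom (Fm \<phi> i))) | \<phi> i.
        \<phi> \<in> cl \<psi> \<and> 1 \<le> i \<and> i \<le> k}"

definition until_constraints ::
    "'a ltl \<Rightarrow> 'a ltl \<Rightarrow> nat \<Rightarrow> ('v, 'a) evar pform set" where
  "until_constraints f g k =
     {PIff (Atom (AuxF g 0)) PFalse,
      PImp (Atom LoopExists) (PImp (Atom (Fm (Until f g) k)) (Atom (AuxF g k)))} \<union>
     {PIff (Atom (AuxF g i))
        (POr (Atom (AuxF g (i - 1))) (PAnd (Atom (InLoop i)) (Atom (Fm g i)))) | i.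
        1 \<le> i \<and> i \<le> k}"

definition release_constraints ::
    "'a ltl \<Rightarrow> 'a ltl \<Rightarrow> nat \<Rightarrow> ('v, 'a) evar pform set" where
  "release_constraints f g k =
     {PIff (Atom (AuxG g 0)) PTrue,
      PImp (Atom LoopExists) (PImp (Atom (AuxG g k)) (Atom (Fm (Release f g) k)))} \<union>
     {PIff (Atom (AuxG g i))
        (PAnd (Atom (AuxG g (i - 1))) (POr (PNot (Atom (InLoop i))) (Atom (Fm g i)))) | i.
        1 \<le> i \<and> i \<le> k}"

definition eventuality_constraints :: "'a ltl \<Rightarrow> nat \<Rightarrow> ('v, 'a) evar pform set" where
  "eventuality_constraints \<psi> k =
     \<Union> {until_constraints f g k | f g. Until f g \<in> cl \<psi>} \<union>
     \<Union> {release_constraints f g k | f g. Release f g \<in> cl \<psi>}"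

definition encoding ::
    "('v, 'a) kripke \<Rightarrow> ('v, 'a) symbolic \<Rightarrow> 'a ltl \<Rightarrow> nat \<Rightarrow> ('v, 'a) evar pform set" where
  "encoding M R \<psi> k =
     model_constraints R k \<union> loop_constraints M k \<union> last_state_constraints \<psi> k \<union>
     formula_constraints R \<psi> k \<union> eventuality_constraints \<psi> k \<union> {Atom (Fm \<psi> 0)}"

section \<open>Sanity checks\<close>

lemma finite_cl: "finite (cl \<psi>)"
  by (induction \<psi>) auto

lemma finite_encoding:
  fixes M :: "('v, 'a) kripke"
  assumes "kripke M"
  shows "finite (encoding M R \<psi> k)"
proof -
  have V: "finite (vars M)" using assms by (simp add: kripke_def)
  have img: "{f i | i. 1 \<le> i \<and> i \<le> k} = f ` {1..k}"
    for f :: "nat \<Rightarrow> ('v, 'a) evar pform" and k by auto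
  have img2: "{f a i | a i. a \<in> A \<and> 1 \<le> i \<and> i \<le> k} = (\<lambda>(a, i). f a i) ` (A \<times> {1..k})"
    for f :: "'a ltl \<Rightarrow> nat \<Rightarrow> ('v, 'a) evar pform" and A k by fastforce
  have img3: "{f a i | a i. a \<in> A \<and> i \<le> k} = (\<lambda>(a, i). f a i) ` (A \<times> {..k})"
    for f :: "'a ltl \<Rightarrow> nat \<Rightarrow> ('v, 'a) evar pform" and A k by fastforce
  have img4: "{f i v | i v. 1 \<le> i \<and> i \<le> k \<and> v \<in> A} = (\<lambda>(i, v). f i v) ` ({1..k} \<times> A)"
    for f :: "nat \<Rightarrow> 'v \<Rightarrow> ('v, 'a) evar pform" and A k by fastforce
  have U: "finite {until_constraints f g k | f g. Until f g \<in> cl \<psi>}"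
    by (rule finite_subset[of _
          "(\<lambda>\<phi>. case \<phi> of Until f g \<Rightarrow> until_constraints f g k | _ \<Rightarrow> {}) ` cl \<psi>"])
      (force simp: finite_cl)+
  have R: "finite {release_constraints f g k | f g. Release f g \<in> cl \<psi>}"
    by (rule finite_subset[of _
          "(\<lambda>\<phi>. case \<phi> of Release f g \<Rightarrow> release_constraints f g k | _ \<Rightarrow> {}) ` cl \<psi>"])
      (force simp: finite_cl)+
  have U': "finite (until_constraints f g k :: ('v, 'a) evar pform set)" for f g
    unfolding until_constraints_def img by simp
  have R': "finite (release_constraints f g k :: ('v, 'a) evar pform set)" for f g
    unfolding release_constraints_def img by simp
  have "finite (eventuality_constraints \<psi> k :: ('v, 'a) evar pform set)"
    unfolding eventuality_constraints_def using U R U' R' by blast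
  moreover have "finite (loop_constraints M k)"
    unfolding loop_constraints_def img img4 using V by simp
  moreover have "finite (model_constraints R k)"
    unfolding model_constraints_def img by simp
  moreover have "finite (formula_constraints R \<psi> k)"
    unfolding formula_constraints_def img3 by (simp add: finite_cl)
  moreover have "finite (last_state_constraints \<psi> k :: ('v, 'a) evar pform set)"
    unfolding last_state_constraints_def img2 by (simp add: finite_cl)
  ultimately show ?thesis
    unfolding encoding_def by simp
qed

lemma pform_of_set:
  assumes "finite V"
  shows "\<exists>f. patoms f \<subseteq> V \<and> (\<forall>s \<subseteq> V. pholds s f \<longleftrightarrow> s \<in> A)"
proof -
  have lits: "\<exists>f. patoms f \<subseteq> V \<and> (\<forall>s. pholds s f \<longleftrightarrow> (\<forall>v\<in>W. v \<in> s \<longleftrightarrow> v \<in> a))"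
    if "finite W" "W \<subseteq> V" for W a
    using that
  proof (induction W rule: finite_induct)
    case empty
    show ?case by (rule exI[of _ PTrue]) simp
  next
    case (insert v W)
    then obtain f where f: "patoms f \<subseteq> V" "\<forall>s. pholds s f \<longleftrightarrow> (\<forall>v\<in>W. v \<in> s \<longleftrightarrow> v \<in> a)" by auto
    show ?case
      by (rule exI[of _ "PAnd f (if v \<in> a then Atom v else PNot (Atom v))"])
        (use f insert.prems in auto)
  qed
  have "\<exists>f. patoms f \<subseteq> V \<and> (\<forall>s \<subseteq> V. pholds s f \<longleftrightarrow> s \<in> B)" if "finite B" "B \<subseteq> Pow V" for B
    using that
  proof (induction B rule: finite_induct)
    case empty
    show ?case by (rule exI[of _ PFalse]) simp
  next
    case (insert b B)
    then obtain f where f: "patoms f \<subseteq> V" "\<forall>s \<subseteq> V. pholds s f \<longleftrightarrow> s \<in> B" by auto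
    obtain g where g: "patoms g \<subseteq> V" "\<forall>s. pholds s g \<longleftrightarrow> (\<forall>v\<in>V. v \<in> s \<longleftrightarrow> v \<in> b)"
      using lits[OF assms] by blast
    have "(\<forall>v\<in>V. v \<in> s \<longleftrightarrow> v \<in> b) \<longleftrightarrow> s = b" if "s \<subseteq> V" for s
      using that insert.prems by blast
    then show ?case
      by (intro exI[of _ "POr f g"]) (use f g in auto)
  qed
  from this[of "A \<inter> Pow V"] assms show ?thesis by auto
qed

lemma kripke_representable:
  assumes "kripke M"
  shows "\<exists>R. represents R M"
proof -
  have V: "finite (vars M)" using assms by (simp add: kripke_def)
  obtain fi where fi: "patoms fi \<subseteq> vars M" "\<forall>s \<subseteq> vars M. pholds s fi \<longleftrightarrow> s \<in> initial M"
    using pform_of_set[OF V, of "initial M"] by (elim exE conjE) (rule that)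
  obtain ft where ft: "patoms ft \<subseteq> vars M <+> vars M"
      "\<forall>u \<subseteq> vars M <+> vars M. pholds u ft \<longleftrightarrow> u \<in> (\<lambda>(s, t). s <+> t) ` transitions M"
    using pform_of_set[OF finite_Plus[OF V V], of "(\<lambda>(s, t). s <+> t) ` transitions M"]
    by (elim exE conjE) (rule that)
  have "\<forall>p. \<exists>f. patoms f \<subseteq> vars M \<and> (\<forall>s \<subseteq> vars M. pholds s f \<longleftrightarrow> s \<in> {s. p \<in> label M s})"
    by (intro allI pform_of_set V)
  then obtain fl where "\<forall>p. patoms (fl p) \<subseteq> vars M \<and>
      (\<forall>s \<subseteq> vars M. pholds s (fl p) \<longleftrightarrow> s \<in> {s. p \<in> label M s})"
    by (rule choice[THEN exE])
  then have fl: "\<And>p. patoms (fl p) \<subseteq> vars M"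
      "\<And>p s. s \<subseteq> vars M \<Longrightarrow> pholds s (fl p) \<longleftrightarrow> s \<in> {s. p \<in> label M s}"
    by simp_all
  have inj: "s <+> t = s' <+> t' \<longleftrightarrow> s = s' \<and> t = t'" for s t s' t' :: "'v set"
    by (auto simp: set_eq_iff Plus_def)
  have "pholds (s <+> t) ft \<longleftrightarrow> (s, t) \<in> transitions M" if "s \<subseteq> vars M" "t \<subseteq> vars M" for s t
  proof -
    have "s <+> t \<subseteq> vars M <+> vars M" using that by blast
    then have "pholds (s <+> t) ft \<longleftrightarrow> (\<exists>x\<in>transitions M. s <+> t = fst x <+> snd x)"
      using ft(2) by (simp add: image_iff case_prod_beta)
    then show ?thesis by (force simp: inj)
  qed
  moreover have "pholds s (fl p) \<longleftrightarrow> p \<in> label M s" if "s \<in> states M" for s p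
    using fl(2)[of s p] that assms by (auto simp: kripke_def)
  ultimately have "represents \<lparr>init_fm = fi, trans_fm = ft, label_fm = fl\<rparr> M"
    unfolding represents_def using fi ft(1) fl(1) by simp
  then show ?thesis ..
qed

end

theory Submission
  imports Defs
begin

text \<open>A satisfying assignment of the encoding is the same thing as a finite path with a selected
  loop start and a truth assignment to the subformulas that obeys the expansion laws of LTL, the
  eventualities being settled inside the loop.  Unwinding such a
  tableau gives an infinite path on which every formula marked true does hold: the expansion laws
  propagate an unfulfilled until around the whole loop, where the auxiliary constraint
  refutes it.  Only this implication is needed, because formulas are in positive normal form.
  Conversely, on a path satisfying \<open>\<psi>\<close> some pair of a state and a set of true subformulas recurs;
  cutting the path between two occurrences that are far enough apart for every pair visited later
  to occur between them gives a tableau that simply records the truth values on the original path.\<close>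

section \<open>Closure and expansion laws\<close>

lemma cl_refl: "\<phi> \<in> cl \<phi>"
  by (cases \<phi>) auto

lemma cl_mono: "\<phi> \<in> cl \<psi> \<Longrightarrow> cl \<phi> \<subseteq> cl \<psi>"
  by (induction \<psi>) auto

lemma cl_subformulas:
  "And f g \<in> cl \<psi> \<Longrightarrow> f \<in> cl \<psi> \<and> g \<in> cl \<psi>"
  "Or f g \<in> cl \<psi> \<Longrightarrow> f \<in> cl \<psi> \<and> g \<in> cl \<psi>"
  "Next f \<in> cl \<psi> \<Longrightarrow> f \<in> cl \<psi>"
  "Until f g \<in> cl \<psi> \<Longrightarrow> f \<in> cl \<psi> \<and> g \<in> cl \<psi>"
  "Release f g \<in> cl \<psi> \<Longrightarrow> f \<in> cl \<psi> \<and> g \<in> cl \<psi>"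
  by (drule cl_mono, use cl_refl in force)+

text \<open>Recursion goes through the oracle \<open>H\<close>, not through the formula. One set of
  laws therefore serves \<open>sat\<close>, \<open>sat_nl\<close> and the variables
  \<open>Fm\<close> of the encoding. On an infinite path these laws alone leave room for an until
  that is postponed for ever.\<close>

fun expand :: "('s \<Rightarrow> 'a set) \<Rightarrow> 's word \<Rightarrow> (nat \<Rightarrow> 'a ltl \<Rightarrow> bool) \<Rightarrow> nat \<Rightarrow> 'a ltl \<Rightarrow> bool" where
  "expand L s H i (Prop p) \<longleftrightarrow> p \<in> L (s i)"
| "expand L s H i (NProp p) \<longleftrightarrow> p \<notin> L (s i)"
| "expand L s H i (And f g) \<longleftrightarrow> H i f \<and> H i g"
| "expand L s H i (Or f g) \<longleftrightarrow> H i f \<or> H i g"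
| "expand L s H i (Next f) \<longleftrightarrow> H (Suc i) f"
| "expand L s H i (Until f g) \<longleftrightarrow> H i g \<or> H i f \<and> H (Suc i) (Until f g)"
| "expand L s H i (Release f g) \<longleftrightarrow> H i g \<and> (H i f \<or> H (Suc i) (Release f g))"

text \<open>The law at \<open>i\<close> reads only the label at \<open>i\<close> and the oracle at
  \<open>i\<close> and its successor. It can thus be moved to another word or indexing, in
  particular to a loop in which the successor of the last position is an earlier one.\<close>

lemma expand_cong:
  assumes "L (s i) = L (t j)"
    and "\<And>\<chi>. \<chi> \<in> cl \<phi> \<Longrightarrow> H i \<chi> \<longleftrightarrow> K j \<chi>"
    and "\<And>\<chi>. \<chi> \<in> cl \<phi> \<Longrightarrow> H (Suc i) \<chi> \<longleftrightarrow> K (Suc j) \<chi>"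
  shows "expand L s H i \<phi> \<longleftrightarrow> expand L t K j \<phi>"
  using assms by (cases \<phi>) (simp_all add: cl_refl)

lemma sat_expand: "sat L \<pi> i \<phi> \<longleftrightarrow> expand L \<pi> (sat L \<pi>) i \<phi>"
proof (cases \<phi>)
  case (Until f g)
  have "sat L \<pi> i (Until f g) \<longleftrightarrow> sat L \<pi> i g \<or> sat L \<pi> i f \<and> sat L \<pi> (Suc i) (Until f g)"
    (is "?l \<longleftrightarrow> ?r")
  proof
    assume ?l
    then obtain j where j: "j \<ge> i" "sat L \<pi> j g" "\<forall>n. i \<le> n \<and> n < j \<longrightarrow> sat L \<pi> n f" by auto
    show ?r
      using j by (cases "j = i") (auto intro!: exI[of _ j])
  next
    assume ?r
    then show ?l
    proof
      assume "sat L \<pi> i f \<and> sat L \<pi> (Suc i) (Until f g)"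
      then obtain j where "j \<ge> Suc i" "sat L \<pi> j g" "sat L \<pi> i f"
        "\<forall>n. Suc i \<le> n \<and> n < j \<longrightarrow> sat L \<pi> n f" by auto
      then show ?l
        by (auto intro!: exI[of _ j]) (metis Suc_leI le_neq_implies_less)
    qed auto
  qed
  then show ?thesis by (simp only: Until expand.simps)
next
  case (Release f g)
  have "sat L \<pi> i (Release f g) \<longleftrightarrow> sat L \<pi> i g \<and> (sat L \<pi> i f \<or> sat L \<pi> (Suc i) (Release f g))"
    (is "?l \<longleftrightarrow> ?r")
  proof
    assume l: ?l
    have "sat L \<pi> j g \<or> (\<exists>n. Suc i \<le> n \<and> n < j \<and> sat L \<pi> n f)"
      if "\<not> sat L \<pi> i f" "Suc i \<le> j" for j
      using l that by simp (metis Suc_leI Suc_leD le_neq_implies_less)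
    then show ?r using l by auto
  next
    assume r: ?r
    show ?l
      unfolding sat.simps
    proof (intro allI impI)
      fix j assume "i \<le> j"
      then consider "j = i" | "Suc i \<le> j" by linarith
      then show "sat L \<pi> j g \<or> (\<exists>n. i \<le> n \<and> n < j \<and> sat L \<pi> n f)"
        using r by cases (auto dest: Suc_leD)
    qed
  qed
  then show ?thesis by (simp only: Release expand.simps)
qed auto

text \<open>The loop-free semantics obeys the ordinary laws once everything beyond \<open>k\<close>
  counts as false. The guard in the oracle matters, since \<open>sat_nl\<close> at
  \<open>Suc k\<close> can still make literals true. Cutting a release off with false forces its
  left argument to occur by \<open>k\<close>, as the bounded semantics demands.\<close>

lemma sat_nl_expand:
  assumes "i \<le> k"
  shows "sat_nl L \<pi> k i \<phi> \<longleftrightarrow> expand L \<pi> (\<lambda>i \<phi>. i \<le> k \<and> sat_nl L \<pi> k i \<phi>) i \<phi>"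
proof (cases \<phi>)
  case (Until f g)
  have "sat_nl L \<pi> k i (Until f g) \<longleftrightarrow>
      sat_nl L \<pi> k i g \<or> sat_nl L \<pi> k i f \<and> Suc i \<le> k \<and> sat_nl L \<pi> k (Suc i) (Until f g)"
    (is "?l \<longleftrightarrow> ?r")
  proof
    assume ?l
    then obtain j where j: "i \<le> j" "j \<le> k" "sat_nl L \<pi> k j g"
      "\<forall>n. i \<le> n \<and> n < j \<longrightarrow> sat_nl L \<pi> k n f" by auto
    show ?r
      using j by (cases "j = i") (auto intro!: exI[of _ j])
  next
    assume ?r
    then show ?l
    proof
      assume "sat_nl L \<pi> k i f \<and> Suc i \<le> k \<and> sat_nl L \<pi> k (Suc i) (Until f g)"
      then obtain j where "j \<ge> Suc i" "j \<le> k" "sat_nl L \<pi> k j g" "sat_nl L \<pi> k i f"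
        "\<forall>n. Suc i \<le> n \<and> n < j \<longrightarrow> sat_nl L \<pi> k n f" by auto
      then show ?l
        by (auto intro!: exI[of _ j]) (metis Suc_leI le_neq_implies_less)
    qed (use assms in auto)
  qed
  then show ?thesis using assms by (simp only: Until expand.simps simp_thms)
next
  case (Release f g)
  have "sat_nl L \<pi> k i (Release f g) \<longleftrightarrow> sat_nl L \<pi> k i g \<and>
      (sat_nl L \<pi> k i f \<or> Suc i \<le> k \<and> sat_nl L \<pi> k (Suc i) (Release f g))"
    (is "?l \<longleftrightarrow> ?r")
  proof
    assume ?l
    then obtain j where j: "i \<le> j" "j \<le> k" "sat_nl L \<pi> k j f"
      "\<forall>n. i \<le> n \<and> n \<le> j \<longrightarrow> sat_nl L \<pi> k n g" by auto
    show ?r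
      using j by (cases "j = i") (auto intro!: exI[of _ j])
  next
    assume r: ?r
    show ?l
    proof (cases "sat_nl L \<pi> k i f")
      case True
      then show ?thesis using r assms by (auto intro!: exI[of _ i] dest: le_antisym)
    next
      case False
      with r obtain j where "j \<ge> Suc i" "j \<le> k" "sat_nl L \<pi> k j f" "sat_nl L \<pi> k i g"
        "\<forall>n. Suc i \<le> n \<and> n \<le> j \<longrightarrow> sat_nl L \<pi> k n g" by auto
      then show ?l
        by (auto intro!: exI[of _ j]) (metis Suc_leI le_neq_implies_less)
    qed
  qed
  then show ?thesis using assms by (simp only: Release expand.simps simp_thms)
qed (use assms in auto)

section \<open>Truth lemma for markings that obey the expansion laws\<close>

text \<open>Without negation of compound formulas, the induction needs only that marked formulas are
  true, never the converse. The laws suffice for a release, which is a greatest fixpoint; an until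
  is a least fixpoint and needs \<open>ev\<close> to exclude endless postponement.\<close>

lemma hintikka_sat:
  assumes exp: "\<And>n \<phi>. \<phi> \<in> cl \<psi> \<Longrightarrow> H n \<phi> \<Longrightarrow> expand L \<pi> H n \<phi>"
    and ev: "\<And>n f g. Until f g \<in> cl \<psi> \<Longrightarrow> \<forall>j\<ge>n. H j (Until f g) \<Longrightarrow> \<exists>j\<ge>n. H j g"
  shows "\<phi> \<in> cl \<psi> \<Longrightarrow> H n \<phi> \<Longrightarrow> sat L \<pi> n \<phi>"
proof (induction \<phi> arbitrary: n)
  case (Prop p)
  then show ?case using exp[of "Prop p" n] by simp
next
  case (NProp p)
  then show ?case using exp[of "NProp p" n] by simp
next
  case (And f g)
  then show ?case using exp[of "And f g" n] by (auto dest!: cl_subformulas(1))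
next
  case (Or f g)
  then show ?case using exp[of "Or f g" n] by (auto dest!: cl_subformulas(2))
next
  case (Next f)
  then show ?case using exp[of "Next f" n] by (auto dest!: cl_subformulas(3))
next
  case (Until f g)
  note c = cl_subformulas(4)[OF Until.prems(1)]
  have step: "H m g \<or> H m f \<and> H (Suc m) (Until f g)" if "H m (Until f g)" for m
    using exp[OF Until.prems(1) that] by simp
  \<comment> \<open>As long as \<open>g\<close> is not marked, the law hands the until on to the
    next position and marks \<open>f\<close> on the way.\<close>
  have run: "H (n + d) (Until f g) \<and> (\<forall>m. n \<le> m \<and> m < n + d \<longrightarrow> H m f)"
    if "\<forall>m. n \<le> m \<and> m < n + d \<longrightarrow> \<not> H m g" for d
    using that
  proof (induction d)
    case (Suc d)
    then have *: "H (n + d) (Until f g)" "\<forall>m. n \<le> m \<and> m < n + d \<longrightarrow> H m f" "\<not> H (n + d) g"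
      by auto
    with step[OF *(1)] show ?case by (auto simp: less_Suc_eq)
  qed (use Until.prems in auto)
  have "\<exists>j\<ge>n. H j g"
  proof (rule ccontr)
    assume no: "\<not> (\<exists>j\<ge>n. H j g)"
    have "H j (Until f g)" if "j \<ge> n" for j
      using run[of "j - n"] no that by auto
    with ev[OF Until.prems(1)] no show False by blast
  qed
  then obtain d where "H (n + d) g" by (auto simp: le_iff_add)
  \<comment> \<open>Taking the first position marked \<open>g\<close> ensures that
    \<open>run\<close> covers everything before it.\<close>
  then have d: "H (n + (LEAST d. H (n + d) g)) g" by (rule LeastI)
  have "\<not> H m g" if "n \<le> m" "m < n + (LEAST d. H (n + d) g)" for m
    using not_less_Least[of "m - n" "\<lambda>d. H (n + d) g"] that by simp
  with run have "\<forall>m. n \<le> m \<and> m < n + (LEAST d. H (n + d) g) \<longrightarrow> H m f" by blast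
  with d c Until.IH show ?case unfolding sat.simps by (metis le_add1)
next
  case (Release f g)
  note c = cl_subformulas(5)[OF Release.prems(1)]
  have step: "H m g \<and> (H m f \<or> H (Suc m) (Release f g))" if "H m (Release f g)" for m
    using exp[OF Release.prems(1) that] by simp
  have run: "H (n + d) (Release f g)" if "\<forall>m. n \<le> m \<and> m < n + d \<longrightarrow> \<not> H m f" for d
    using that
  proof (induction d)
    case (Suc d)
    then have "H (n + d) (Release f g)" "\<not> H (n + d) f" by auto
    with step show ?case by auto
  qed (use Release.prems in simp)
  have "H j g \<or> (\<exists>m. n \<le> m \<and> m < j \<and> H m f)" if "j \<ge> n" for j
    using run[of "j - n"] step[of j] that by auto
  then show ?case using c Release.IH unfolding sat.simps by blast
qed

section \<open>Tableaux\<close>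

text \<open>The selected loop is \<open>{l..k}\<close>, and \<open>l = Suc k\<close> encodes that no loop is selected.\<close>

definition tableau ::
    "('v, 'a) kripke \<Rightarrow> 'a ltl \<Rightarrow> nat \<Rightarrow> nat \<Rightarrow> 'v set word \<Rightarrow> (nat \<Rightarrow> 'a ltl \<Rightarrow> bool) \<Rightarrow> bool" where
  "tableau M \<psi> k l s H \<longleftrightarrow>
     s 0 \<in> initial M \<and> (\<forall>i<k. (s i, s (Suc i)) \<in> transitions M) \<and>
     0 < l \<and> l \<le> Suc k \<and> (l \<le> k \<longrightarrow> s (l - 1) = s k) \<and>
     (\<forall>\<phi>\<in>cl \<psi>. \<forall>i\<le>k. H i \<phi> \<longleftrightarrow> expand (label M) s H i \<phi>) \<and>
     (\<forall>\<phi>\<in>cl \<psi>. H (Suc k) \<phi> \<longleftrightarrow> l \<le> k \<and> H l \<phi>) \<and>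
     (\<forall>f g. l \<le> k \<and> Until f g \<in> cl \<psi> \<and> H k (Until f g) \<longrightarrow> (\<exists>j. l \<le> j \<and> j \<le> k \<and> H j g)) \<and>
     (\<forall>f g. l \<le> k \<and> Release f g \<in> cl \<psi> \<and> (\<forall>j. l \<le> j \<and> j \<le> k \<longrightarrow> H j g) \<longrightarrow>
        H k (Release f g)) \<and>
     H 0 \<psi>"

section \<open>Soundness: unwinding a tableau into an infinite path\<close>

lemma path_states:
  assumes "kripke M" "s 0 \<in> initial M" "\<forall>i<k. (s i, s (Suc i)) \<in> transitions M" "i \<le> k"
  shows "s i \<in> states M"
proof (cases i)
  case 0
  then show ?thesis using assms by (auto simp: kripke_def)
next
  case (Suc j)
  then have "(s j, s i) \<in> transitions M" using assms by auto
  then show ?thesis using assms(1) by (auto simp: kripke_def)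
qed

lemma path_extends:
  assumes "kripke M" "s 0 \<in> initial M" "\<forall>i<k. (s i, s (Suc i)) \<in> transitions M"
  shows "\<exists>\<pi>. initialised_path M \<pi> \<and> (\<forall>i\<le>k. \<pi> i = s i)"
proof -
  from assms(1) obtain nxt where nxt: "\<And>x. x \<in> states M \<Longrightarrow> (x, nxt x) \<in> transitions M"
    unfolding kripke_def by metis
  \<comment> \<open>Subtraction is truncated: up to \<open>k\<close> there is no iteration and the
    value is \<open>s i\<close>; afterwards \<open>nxt\<close> is iterated from
    \<open>s k\<close>.\<close>
  let ?\<pi> = "\<lambda>i. (nxt ^^ (i - k)) (s (min i k))"
  have "(?\<pi> i, ?\<pi> (Suc i)) \<in> transitions M \<and> ?\<pi> i \<in> states M" for i
  proof (induction i)
    case 0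
    show ?case using assms nxt[of "s 0"] by (cases k) (auto simp: kripke_def)
  next
    case (Suc i)
    then have st: "?\<pi> (Suc i) \<in> states M" using assms(1) by (auto simp: kripke_def)
    show ?case
    proof (cases "Suc i < k")
      case True
      then show ?thesis using assms(3) st by (auto simp: min_def)
    next
      case False
      then show ?thesis using nxt[OF st] st by (auto simp: min_def Suc_diff_le)
    qed
  qed
  then have "initialised_path M ?\<pi>" using assms(2) by (simp add: initialised_path_def)
  then show ?thesis by (intro exI[of _ ?\<pi>]) auto
qed

text \<open>This is the index sequence of the lasso: it runs from 0 to \<open>k\<close> and then
  cycles through \<open>{l..k}\<close>. Composing with it unwinds states and markings alike.\<close>

primrec lasso_pos :: "nat \<Rightarrow> nat \<Rightarrow> nat \<Rightarrow> nat" where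
  "lasso_pos l k 0 = 0"
| "lasso_pos l k (Suc n) = (if lasso_pos l k n = k then l else Suc (lasso_pos l k n))"

lemma lasso_pos_le: "l \<le> k \<Longrightarrow> lasso_pos l k n \<le> k"
  by (induction n) auto

lemma lasso_pos_add:
  "lasso_pos l k n + d \<le> k \<Longrightarrow> lasso_pos l k (n + d) = lasso_pos l k n + d"
  by (induction d) auto

text \<open>From any time \<open>n\<close> the walk goes up to \<open>k\<close>, jumps to
  \<open>l\<close> and then climbs to \<open>j\<close>.\<close>

lemma lasso_pos_recurs:
  assumes "l \<le> j" "j \<le> k"
  shows "\<exists>m\<ge>n. lasso_pos l k m = j"
proof -
  let ?m = "n + (k - lasso_pos l k n)"
  have "lasso_pos l k n \<le> k" using assms lasso_pos_le[of l k n] by simp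
  then have "lasso_pos l k ?m = k" by (subst lasso_pos_add) auto
  then have "lasso_pos l k (Suc ?m) = l" by simp
  then have "lasso_pos l k (Suc ?m + (j - l)) = j" using assms by (subst lasso_pos_add) auto
  then show ?thesis by (intro exI[of _ "Suc ?m + (j - l)"]) simp
qed

lemma tableau_sound:
  assumes K: "kripke M" and T: "tableau M \<psi> k l s H"
  shows "\<exists>\<pi>. initialised_path M \<pi> \<and> sat (label M) \<pi> 0 \<psi>"
proof -
  have path: "s 0 \<in> initial M" "\<forall>i<k. (s i, s (Suc i)) \<in> transitions M"
    and l: "0 < l" "l \<le> Suc k" "l \<le> k \<Longrightarrow> s (l - 1) = s k"
    and exp: "\<And>\<phi> i. \<phi> \<in> cl \<psi> \<Longrightarrow> i \<le> k \<Longrightarrow> H i \<phi> \<longleftrightarrow> expand (label M) s H i \<phi>"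
    and last: "\<And>\<phi>. \<phi> \<in> cl \<psi> \<Longrightarrow> H (Suc k) \<phi> \<longleftrightarrow> l \<le> k \<and> H l \<phi>"
    and ev: "\<And>f g. l \<le> k \<Longrightarrow> Until f g \<in> cl \<psi> \<Longrightarrow> H k (Until f g) \<Longrightarrow> \<exists>j. l \<le> j \<and> j \<le> k \<and> H j g"
    and H0: "H 0 \<psi>"
    using T unfolding tableau_def by blast+
  show ?thesis
  proof (cases "l \<le> k")
    case True
    let ?p = "lasso_pos l k"
    let ?K = "\<lambda>n. H (?p n)"
    have "(s (?p n), s (?p (Suc n))) \<in> transitions M" for n
    proof (cases "?p n = k")
      case True
      \<comment> \<open>The jump from \<open>k\<close> to \<open>l\<close> is a transition because
        it copies the one from \<open>l - 1\<close> to \<open>l\<close>, the states at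
        \<open>l - 1\<close> and \<open>k\<close> being equal.\<close>
      then show ?thesis
        using path(2)[rule_format, of "l - 1"] l \<open>l \<le> k\<close> by simp
    next
      case False
      then show ?thesis using path(2) lasso_pos_le[OF True, of n] by simp
    qed
    then have "initialised_path M (s \<circ> ?p)" using path(1) by (simp add: initialised_path_def)
    moreover have "sat (label M) (s \<circ> ?p) 0 \<psi>"
    proof (rule hintikka_sat[where H = ?K and \<psi> = \<psi>])
      fix n \<phi> assume c: "\<phi> \<in> cl \<psi>" and h: "?K n \<phi>"
      \<comment> \<open>At \<open>k\<close> the tableau looks at \<open>Suc k\<close> and the
        unwinding at \<open>l\<close>; the last-state condition identifies the two markings.\<close>
      have "H (Suc (?p n)) \<chi> \<longleftrightarrow> ?K (Suc n) \<chi>" if "\<chi> \<in> cl \<phi>" for \<chi>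
        using last[of \<chi>] cl_mono[OF c] that True by auto
      then have "expand (label M) s H (?p n) \<phi> \<longleftrightarrow> expand (label M) (s \<circ> ?p) ?K n \<phi>"
        by (intro expand_cong) auto
      with h exp[OF c lasso_pos_le[OF True]] show "expand (label M) (s \<circ> ?p) ?K n \<phi>" by blast
    next
      fix n f g assume c: "Until f g \<in> cl \<psi>" and u: "\<forall>j\<ge>n. ?K j (Until f g)"
      \<comment> \<open>An until that is marked for ever is marked when the walk passes
        \<open>k\<close>, the only place where the eventuality condition is stated. The witness it
        yields in the loop is visited again after \<open>n\<close>.\<close>
      obtain m where "m \<ge> n" "?p m = k" using lasso_pos_recurs[OF True order_refl] by blast
      with u have "H k (Until f g)" by metis
      then obtain j where j: "l \<le> j" "j \<le> k" "H j g" using ev[OF True c] by blast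
      then obtain m' where "m' \<ge> n" "?p m' = j" using lasso_pos_recurs by blast
      with j show "\<exists>j\<ge>n. ?K j g" by blast
    qed (use H0 cl_refl in auto)
    ultimately show ?thesis by blast
  next
    case False
    obtain \<pi> where \<pi>: "initialised_path M \<pi>" "\<forall>i\<le>k. \<pi> i = s i"
      using path_extends[OF K path] by blast
    \<comment> \<open>Without a loop nothing is marked beyond \<open>k\<close>, so the choice of the
      path after \<open>k\<close> is irrelevant.\<close>
    let ?K = "\<lambda>n \<phi>. n \<le> k \<and> H n \<phi>"
    have "sat (label M) \<pi> 0 \<psi>"
    proof (rule hintikka_sat[where H = ?K and \<psi> = \<psi>])
      fix n \<phi> assume c: "\<phi> \<in> cl \<psi>" and h: "?K n \<phi>"
      have "H (Suc n) \<chi> \<longleftrightarrow> ?K (Suc n) \<chi>" if "\<chi> \<in> cl \<phi>" for \<chi>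
        using last[of \<chi>] cl_mono[OF c] that False h by (cases "n = k") auto
      then have "expand (label M) s H n \<phi> \<longleftrightarrow> expand (label M) \<pi> ?K n \<phi>"
        using \<pi>(2) h by (intro expand_cong) auto
      with h exp[OF c] show "expand (label M) \<pi> ?K n \<phi>" by blast
    next
      fix n f g assume "\<forall>j\<ge>n. ?K j (Until f g)"
      \<comment> \<open>No formula is marked for ever, so the premise is contradictory.\<close>
      then have "n + Suc k \<le> k" by (metis le_add1)
      then show "\<exists>j\<ge>n. ?K j g" by simp
    qed (use H0 cl_refl in auto)
    then show ?thesis using \<pi>(1) by blast
  qed
qed

section \<open>Completeness: cutting a satisfying path into a lasso\<close>

text \<open>The path may be aperiodic: the tableau records its truth values up to \<open>b\<close>
  and only redirects \<open>Suc b\<close> to \<open>Suc a\<close>. The expansion laws survive at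
  \<open>b\<close> because \<open>a\<close> and \<open>b\<close> agree on the closure, and
  \<open>cover\<close> brings all later events back into the loop \<open>{Suc a..b}\<close>.\<close>

lemma tableau_lasso:
  assumes path: "initialised_path M \<pi>" and sat: "sat (label M) \<pi> 0 \<psi>"
    and ab: "a < b" "\<pi> a = \<pi> b"
    and type: "\<And>\<phi>. \<phi> \<in> cl \<psi> \<Longrightarrow> sat (label M) \<pi> a \<phi> \<longleftrightarrow> sat (label M) \<pi> b \<phi>"
    and cover: "\<And>j. a < j \<Longrightarrow> \<exists>i. a < i \<and> i \<le> b \<and>
      (\<forall>\<phi>\<in>cl \<psi>. sat (label M) \<pi> i \<phi> \<longleftrightarrow> sat (label M) \<pi> j \<phi>)"
  shows "tableau M \<psi> b (Suc a) \<pi> (\<lambda>i. sat (label M) \<pi> (if i = Suc b then Suc a else i))"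
    (is "tableau M \<psi> b (Suc a) \<pi> ?H")
  unfolding tableau_def
proof (intro conjI ballI allI impI)
  fix \<phi> i assume c: "\<phi> \<in> cl \<psi>" and i: "i \<le> b"
  show "?H i \<phi> \<longleftrightarrow> expand (label M) \<pi> ?H i \<phi>"
  proof (cases "i = b")
    case True
    \<comment> \<open>At \<open>b\<close> the redirected successor is \<open>Suc a\<close>, so the
      law valid at \<open>a\<close> is the one required here.\<close>
    have "expand (label M) \<pi> (sat (label M) \<pi>) a \<phi> \<longleftrightarrow> expand (label M) \<pi> ?H b \<phi>"
      using ab type cl_mono[OF c] by (intro expand_cong) auto
    then show ?thesis using True type[OF c] sat_expand[of "label M" \<pi> a \<phi>] by simp
  next
    case False
    have "expand (label M) \<pi> (sat (label M) \<pi>) i \<phi> \<longleftrightarrow> expand (label M) \<pi> ?H i \<phi>"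
      using False i by (intro expand_cong) auto
    then show ?thesis using i sat_expand[of "label M" \<pi> i \<phi>] by simp
  qed
next
  have mid: "\<exists>i. a < i \<and> i \<le> b \<and> (\<forall>\<phi>\<in>cl \<psi>. sat (label M) \<pi> i \<phi> \<longleftrightarrow> sat (label M) \<pi> j \<phi>)"
    if "b \<le> j" for j
    using cover[of j] that ab(1) by simp
  {
    fix f g assume "Suc a \<le> b \<and> Until f g \<in> cl \<psi> \<and> ?H b (Until f g)"
    then have c: "Until f g \<in> cl \<psi>" and "sat (label M) \<pi> b (Until f g)" by auto
    then obtain j where "b \<le> j" "sat (label M) \<pi> j g" by auto
    with mid[of j] cl_subformulas(4)[OF c] obtain i where "a < i" "i \<le> b" "sat (label M) \<pi> i g"
      by blast
    then show "\<exists>j\<ge>Suc a. j \<le> b \<and> ?H j g" by (intro exI[of _ i]) auto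
  }
  {
    fix f g assume "Suc a \<le> b \<and> Release f g \<in> cl \<psi> \<and> (\<forall>j. Suc a \<le> j \<and> j \<le> b \<longrightarrow> ?H j g)"
    then have c: "Release f g \<in> cl \<psi>" and all: "\<And>j. a < j \<Longrightarrow> j \<le> b \<Longrightarrow> sat (label M) \<pi> j g"
      by (auto simp: Suc_le_eq split: if_splits)
    \<comment> \<open>Every position from \<open>b\<close> on agrees with some loop position, where
      \<open>g\<close> holds; so \<open>g\<close> holds for ever after \<open>b\<close> and the
      release is true whatever \<open>f\<close> does.\<close>
    have "sat (label M) \<pi> j g" if "b \<le> j" for j
      using mid[OF that] all cl_subformulas(5)[OF c] by blast
    then show "?H b (Release f g)" by simp
  }
qed (use assms in \<open>auto simp: initialised_path_def\<close>)

text \<open>Choose \<open>a\<close> whose value recurs infinitely often. Finitely many positions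
  after \<open>a\<close> represent all values taken after \<open>a\<close>, and \<open>b\<close> is
  a recurrence beyond all of them.\<close>

lemma finite_range_lasso:
  fixes \<tau> :: "nat \<Rightarrow> 'b"
  assumes "finite (range \<tau>)"
  shows "\<exists>a b. a < b \<and> \<tau> a = \<tau> b \<and> (\<forall>j>a. \<exists>i. a < i \<and> i \<le> b \<and> \<tau> i = \<tau> j)"
proof -
  obtain a where inf: "infinite {i. \<tau> i = \<tau> a}"
    using pigeonhole_infinite[OF infinite_UNIV_nat assms] by auto
  have "finite (\<tau> ` {a<..})" using assms by (rule finite_subset[rotated]) auto
  then obtain C where C: "C \<subseteq> {a<..}" "finite C" "\<tau> ` {a<..} = \<tau> ` C"
    using finite_subset_image[OF _ order_refl] by metis
  obtain N where N: "\<And>i. i \<in> C \<Longrightarrow> i \<le> N" using C(2) by (meson finite_nat_set_iff_bounded_le)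
  obtain b where b: "b > max a N" "\<tau> b = \<tau> a"
    using inf unfolding infinite_nat_iff_unbounded by blast
  have "\<exists>i. a < i \<and> i \<le> b \<and> \<tau> i = \<tau> j" if "j > a" for j
  proof -
    have "\<tau> j \<in> \<tau> ` C" using that C(3) by blast
    then obtain i where "i \<in> C" "\<tau> i = \<tau> j" by auto
    then show ?thesis using C(1) N[of i] b(1) by auto
  qed
  then show ?thesis using b by (intro exI[of _ a] exI[of _ b]) auto
qed

lemma tableau_exists:
  assumes K: "kripke M" and path: "initialised_path M \<pi>" and sat: "sat (label M) \<pi> 0 \<psi>"
  shows "\<exists>k l s H. tableau M \<psi> k l s H"
proof -
  \<comment> \<open>Pairing the state with its true closure formulas delivers both requirements of
    \<open>tableau_lasso\<close> at once; finitely many states and a finite closure leave finitely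
    many pairs.\<close>
  let ?\<tau> = "\<lambda>i. (\<pi> i, {\<phi> \<in> cl \<psi>. sat (label M) \<pi> i \<phi>})"
  have st: "\<pi> i \<in> states M" for i
    using path K by (auto simp: initialised_path_def kripke_def)
  have "finite (states M)" using K finite_subset by (auto simp: kripke_def)
  then have fin: "finite (range ?\<tau>)"
    using st finite_cl[of \<psi>] by (intro finite_subset[of "range ?\<tau>" "states M \<times> Pow (cl \<psi>)"]) auto
  obtain a b where ab: "a < b" "?\<tau> a = ?\<tau> b"
    and cover: "\<forall>j>a. \<exists>i. a < i \<and> i \<le> b \<and> ?\<tau> i = ?\<tau> j"
    using finite_range_lasso[OF fin] by (elim exE conjE) (rule that)
  have "tableau M \<psi> b (Suc a) \<pi> (\<lambda>i. sat (label M) \<pi> (if i = Suc b then Suc a else i))"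
  proof (rule tableau_lasso[OF path sat ab(1)])
    fix j assume "a < j"
    then obtain i where "a < i" "i \<le> b" "?\<tau> i = ?\<tau> j" using cover by blast
    then show "\<exists>i. a < i \<and> i \<le> b \<and> (\<forall>\<phi>\<in>cl \<psi>. sat (label M) \<pi> i \<phi> \<longleftrightarrow> sat (label M) \<pi> j \<phi>)"
      by blast
  qed (use ab(2) in auto)
  then show ?thesis by blast
qed

section \<open>Bounded satisfaction\<close>

lemma sat_suffix: "sat L (suffix d \<pi>) i \<phi> \<longleftrightarrow> sat L \<pi> (d + i) \<phi>"
proof (induction \<phi> arbitrary: i)
  case (Until f g)
  have "(\<exists>j\<ge>d + i. P j \<and> (\<forall>n. d + i \<le> n \<and> n < j \<longrightarrow> Q n)) \<longleftrightarrow>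
      (\<exists>j\<ge>i. P (d + j) \<and> (\<forall>n. i \<le> n \<and> n < j \<longrightarrow> Q (d + n)))" (is "?l \<longleftrightarrow> ?r") for P Q
  proof
    assume ?l
    then obtain j where "j \<ge> d + i" "P j" "\<forall>n. d + i \<le> n \<and> n < j \<longrightarrow> Q n" by blast
    then show ?r by (intro exI[of _ "j - d"]) auto
  next
    assume ?r
    then obtain j where j: "j \<ge> i" "P (d + j)" "\<forall>n. i \<le> n \<and> n < j \<longrightarrow> Q (d + n)" by blast
    have "Q n" if "d + i \<le> n" "n < d + j" for n
    proof -
      have "i \<le> n - d" "n - d < j" "d + (n - d) = n" using that by linarith+
      then show ?thesis using j(3) by metis
    qed
    then show ?l using j by (intro exI[of _ "d + j"]) auto
  qed
  then show ?case unfolding sat.simps Until.IH by (rule sym)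
next
  case (Release f g)
  have "(\<forall>j\<ge>d + i. P j \<or> (\<exists>n. d + i \<le> n \<and> n < j \<and> Q n)) \<longleftrightarrow>
      (\<forall>j\<ge>i. P (d + j) \<or> (\<exists>n. i \<le> n \<and> n < j \<and> Q (d + n)))" (is "?l \<longleftrightarrow> ?r") for P Q
  proof
    assume l: ?l
    show ?r
    proof (intro allI impI)
      fix j assume "i \<le> j"
      then have "d + i \<le> d + j" by simp
      with l consider "P (d + j)" | n where "d + i \<le> n" "n < d + j" "Q n" by blast
      then show "P (d + j) \<or> (\<exists>n. i \<le> n \<and> n < j \<and> Q (d + n))"
      proof cases
        case (2 n)
        then have "i \<le> n - d" "n - d < j" "d + (n - d) = n" by linarith+
        with 2(3) show ?thesis by metis
      qed blast
    qed
  next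
    assume r: ?r
    show ?l
    proof (intro allI impI)
      fix j assume j: "d + i \<le> j"
      then have "i \<le> j - d" "d + (j - d) = j" by linarith+
      with r consider "P j" | n where "i \<le> n" "n < j - d" "Q (d + n)" by metis
      then show "P j \<or> (\<exists>n. d + i \<le> n \<and> n < j \<and> Q n)"
      proof cases
        case (2 n)
        then have "d + i \<le> d + n" "d + n < j" by linarith+
        with 2(3) show ?thesis by blast
      qed blast
    qed
  qed
  then show ?case unfolding sat.simps Release.IH by (rule sym)
qed auto

text \<open>The period is valid one position before the loop starts, since the states at
  \<open>l - 1\<close> and \<open>k\<close> agree. This extra position is what lets
  \<open>l - 1\<close> play the role of \<open>a\<close> in \<open>tableau_lasso\<close>.\<close>

lemma kl_loop_period:
  assumes "kl_loop \<pi> k l" "l - 1 \<le> i"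
  shows "\<pi> (i + (Suc k - l)) = \<pi> i"
proof (cases "l \<le> i")
  case True
  have l: "0 < l" "l \<le> k" and eq: "\<pi> = (\<pi> [0 \<rightarrow> l]) \<frown> (\<pi> [l \<rightarrow> Suc k])\<^sup>\<omega>"
    using assms(1) by (auto simp: kl_loop_def)
  have "\<pi> j = \<pi> [l \<rightarrow> Suc k] ! ((j - l) mod (Suc k - l))" if "l \<le> j" for j
    using that l by (subst eq) (simp add: conc_def Suc_diff_le)
  moreover have "i + (Suc k - l) - l = (i - l) + (Suc k - l)" using True by simp
  ultimately show ?thesis using True by (metis mod_add_self2 trans_le_add1)
next
  case False
  \<comment> \<open>Here \<open>i\<close> plus the period is exactly \<open>k\<close>.\<close>
  then have "i = l - 1" using assms(2) by simp
  then show ?thesis using assms(1) by (auto simp: kl_loop_def)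
qed

lemma kl_loop_sat_period:
  assumes "kl_loop \<pi> k l" "l - 1 \<le> i"
  shows "sat L \<pi> (i + (Suc k - l)) \<phi> \<longleftrightarrow> sat L \<pi> i \<phi>"
proof -
  have "suffix (i + (Suc k - l)) \<pi> = suffix i \<pi>"
    using kl_loop_period[OF assms(1)] assms(2)
    by (simp add: suffix_def fun_eq_iff) (metis add.commute add.left_commute trans_le_add1)
  then show ?thesis
    using sat_suffix[of L "i + (Suc k - l)" \<pi> 0 \<phi>] sat_suffix[of L i \<pi> 0 \<phi>] by simp
qed

text \<open>The bound \<open>k\<close> is preserved: a looping path already contains its lasso, with
  \<open>a = l - 1\<close> and \<open>b = k\<close>, and the loop-free semantics is itself a tableau
  without a loop.\<close>

lemma tableau_bounded_sat:
  assumes path: "initialised_path M \<pi>" and b: "bounded_sat (label M) \<pi> k \<psi>"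
  shows "\<exists>l s H. tableau M \<psi> k l s H"
proof -
  from b consider l where "kl_loop \<pi> k l" "sat (label M) \<pi> 0 \<psi>" | "sat_nl (label M) \<pi> k 0 \<psi>"
    unfolding bounded_sat_def by blast
  then show ?thesis
  proof cases
    case (1 l)
    let ?p = "Suc k - l"
    have l: "0 < l" "l \<le> k" "\<pi> (l - 1) = \<pi> k" using 1 by (auto simp: kl_loop_def)
    have k: "l - 1 + ?p = k" using l by simp
    have "tableau M \<psi> k (Suc (l - 1)) \<pi>
        (\<lambda>i. sat (label M) \<pi> (if i = Suc k then Suc (l - 1) else i))"
    proof (rule tableau_lasso[OF path 1(2) _ l(3)])
      show "l - 1 < k" using l by simp
      show "sat (label M) \<pi> (l - 1) \<phi> \<longleftrightarrow> sat (label M) \<pi> k \<phi>" for \<phi>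
        using kl_loop_sat_period[OF 1(1), of "l - 1" "label M" \<phi>] k by simp
      show "\<exists>i. l - 1 < i \<and> i \<le> k \<and> (\<forall>\<phi>\<in>cl \<psi>. sat (label M) \<pi> i \<phi> \<longleftrightarrow> sat (label M) \<pi> j \<phi>)"
        if "l - 1 < j" for j
        using that
      proof (induction j rule: less_induct)
        case (less j)
        show ?case
        proof (cases "j \<le> k")
          case False
          \<comment> \<open>Subtracting the period keeps truth values and stays beyond
            \<open>l - 1\<close>, so repetition ends inside the loop.\<close>
          then have "l - 1 < j - ?p" "j - ?p < j" "j - ?p + ?p = j" using l by auto
          then show ?thesis
            using less.IH[of "j - ?p"] kl_loop_sat_period[OF 1(1), of "j - ?p" "label M"] by simp
        qed (use less.prems in blast)
      qed
    qed
    then show ?thesis by blast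
  next
    case 2
    have "tableau M \<psi> k (Suc k) \<pi> (\<lambda>i \<phi>. i \<le> k \<and> sat_nl (label M) \<pi> k i \<phi>)"
      (is "tableau M \<psi> k (Suc k) \<pi> ?H")
      unfolding tableau_def
    proof (intro conjI ballI allI impI)
      show "?H i \<phi> \<longleftrightarrow> expand (label M) \<pi> ?H i \<phi>" if "i \<le> k" for i \<phi>
        using sat_nl_expand[OF that, of "label M" \<pi> \<phi>] that by simp
    qed (use path 2 in \<open>auto simp: initialised_path_def\<close>)
    then show ?thesis by blast
  qed
qed

section \<open>Tableaux and satisfying assignments\<close>

lemma pholds_map: "pholds \<nu> (map_pform h f) \<longleftrightarrow> pholds (h -` \<nu>) f"
  by (induction f) auto

lemma pholds_cong: "(\<And>x. x \<in> patoms f \<Longrightarrow> x \<in> \<mu> \<longleftrightarrow> x \<in> \<nu>) \<Longrightarrow> pholds \<mu> f \<longleftrightarrow> pholds \<nu> f"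
  by (induction f) auto

text \<open>Copies of variables outside \<open>vars M\<close> are unconstrained and are discarded,
  because \<open>represents\<close> fixes the formulas only on subsets of
  \<open>vars M\<close>.\<close>

definition state_at :: "('v, 'a) kripke \<Rightarrow> ('v, 'a) evar set \<Rightarrow> nat \<Rightarrow> 'v set" where
  "state_at M \<nu> i = {v \<in> vars M. Copy v i \<in> \<nu>}"

lemma pholds_copy_at:
  assumes "patoms f \<subseteq> vars M"
  shows "pholds \<nu> (copy_at i f) \<longleftrightarrow> pholds (state_at M \<nu> i) f"
  unfolding copy_at_def pholds_map
  by (rule pholds_cong) (use assms in \<open>auto simp: state_at_def\<close>)

lemma pholds_between:
  assumes "patoms f \<subseteq> vars M <+> vars M"
  shows "pholds \<nu> (between i j f) \<longleftrightarrow> pholds (state_at M \<nu> i <+> state_at M \<nu> j) f"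
  unfolding between_def pholds_map
  by (rule pholds_cong) (use assms in \<open>auto simp: state_at_def split: sum.splits\<close>)

lemma model_constraints_iff:
  assumes R: "represents R M"
  shows "(\<forall>f\<in>model_constraints R k. pholds \<nu> f) \<longleftrightarrow>
    state_at M \<nu> 0 \<in> initial M \<and>
    (\<forall>i<k. (state_at M \<nu> i, state_at M \<nu> (Suc i)) \<in> transitions M)"
proof -
  have V: "state_at M \<nu> i \<subseteq> vars M" for i by (auto simp: state_at_def)
  have I: "pholds \<nu> (copy_at 0 (init_fm R)) \<longleftrightarrow> state_at M \<nu> 0 \<in> initial M"
    using R V pholds_copy_at by (metis represents_def)
  have T: "pholds \<nu> (between i j (trans_fm R)) \<longleftrightarrow> (state_at M \<nu> i, state_at M \<nu> j) \<in> transitions M"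
    for i j
    using R V pholds_between by (metis represents_def)
  have "(\<forall>f\<in>{between (i - 1) i (trans_fm R) | i. 1 \<le> i \<and> i \<le> k}. pholds \<nu> f) \<longleftrightarrow>
      (\<forall>i<k. pholds \<nu> (between i (Suc i) (trans_fm R)))" (is "?l \<longleftrightarrow> ?r")
  proof
    assume l: ?l
    show ?r
    proof (intro allI impI)
      fix i assume "i < k"
      then show "pholds \<nu> (between i (Suc i) (trans_fm R))"
        using l by (intro bspec[OF l]) (auto intro!: exI[of _ "Suc i"])
    qed
  next
    assume r: ?r
    have "pholds \<nu> (between (i - 1) i (trans_fm R))" if "1 \<le> i" "i \<le> k" for i
      using r[rule_format, of "i - 1"] that by simp
    then show ?l by blast
  qed
  then show ?thesis unfolding model_constraints_def using I T by auto
qed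

text \<open>The label formulas are only known to be correct on \<open>states M\<close>, hence the
  second hypothesis.\<close>

lemma pholds_unfold_fm:
  assumes "represents R M" "state_at M \<nu> i \<in> states M"
  shows "pholds \<nu> (unfold_fm R i \<phi>) \<longleftrightarrow>
    expand (label M) (state_at M \<nu>) (\<lambda>i \<phi>. Fm \<phi> i \<in> \<nu>) i \<phi>"
proof -
  have "pholds \<nu> (copy_at i (label_fm R p)) \<longleftrightarrow> p \<in> label M (state_at M \<nu> i)" for p
    using assms pholds_copy_at by (metis represents_def)
  then show ?thesis by (cases \<phi>) auto
qed

section \<open>Translation between tableaux and assignments\<close>

lemma tableau_satisfiable:
  fixes M :: "('v, 'a) kripke"
  assumes K: "kripke M" and R: "represents R M" and T: "tableau M \<psi> k l s H"
  shows "satisfiable (encoding M R \<psi> k)"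
proof -
  have path: "s 0 \<in> initial M" "\<forall>i<k. (s i, s (Suc i)) \<in> transitions M"
    and l: "0 < l" "l \<le> Suc k" "l \<le> k \<Longrightarrow> s (l - 1) = s k"
    and exp: "\<And>\<phi> i. \<phi> \<in> cl \<psi> \<Longrightarrow> i \<le> k \<Longrightarrow> H i \<phi> \<longleftrightarrow> expand (label M) s H i \<phi>"
    and last: "\<And>\<phi>. \<phi> \<in> cl \<psi> \<Longrightarrow> H (Suc k) \<phi> \<longleftrightarrow> l \<le> k \<and> H l \<phi>"
    and evU: "\<And>f g. l \<le> k \<Longrightarrow> Until f g \<in> cl \<psi> \<Longrightarrow> H k (Until f g) \<Longrightarrow> \<exists>j. l \<le> j \<and> j \<le> k \<and> H j g"
    and evR: "\<And>f g. l \<le> k \<Longrightarrow> Release f g \<in> cl \<psi> \<Longrightarrow> \<forall>j. l \<le> j \<and> j \<le> k \<longrightarrow> H j g \<Longrightarrow>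
      H k (Release f g)"
    and H0: "H 0 \<psi>"
    using T unfolding tableau_def by blast+
  \<comment> \<open>The auxiliary variables at \<open>i\<close> are the disjunction and the
    conjunction of the markings over \<open>{l..i}\<close>; as \<open>0 < l\<close>, these are empty
    at 0. For \<open>l = Suc k\<close>, no selector up to \<open>k\<close> is true and
    \<open>LoopExists\<close> is false.\<close>
  define \<nu> :: "('v, 'a) evar set" where
    "\<nu> = {x. case x of Copy v i \<Rightarrow> v \<in> s i | Lsel i \<Rightarrow> i = l | InLoop i \<Rightarrow> l \<le> i
      | LoopExists \<Rightarrow> l \<le> k | Fm \<phi> i \<Rightarrow> H i \<phi>
      | AuxF \<phi> i \<Rightarrow> (\<exists>j. l \<le> j \<and> j \<le> i \<and> H j \<phi>)
      | AuxG \<phi> i \<Rightarrow> (\<forall>j. l \<le> j \<and> j \<le> i \<longrightarrow> H j \<phi>)}"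
  have \<nu>: "\<And>v i. Copy v i \<in> \<nu> \<longleftrightarrow> v \<in> s i" "\<And>i. Lsel i \<in> \<nu> \<longleftrightarrow> i = l"
    "\<And>i. InLoop i \<in> \<nu> \<longleftrightarrow> l \<le> i" "LoopExists \<in> \<nu> \<longleftrightarrow> l \<le> k"
    "\<And>\<phi> i. Fm \<phi> i \<in> \<nu> \<longleftrightarrow> H i \<phi>"
    "\<And>\<phi> i. AuxF \<phi> i \<in> \<nu> \<longleftrightarrow> (\<exists>j. l \<le> j \<and> j \<le> i \<and> H j \<phi>)"
    "\<And>\<phi> i. AuxG \<phi> i \<in> \<nu> \<longleftrightarrow> (\<forall>j. l \<le> j \<and> j \<le> i \<longrightarrow> H j \<phi>)"
    by (simp_all add: \<nu>_def)
  have st: "s i \<in> states M" if "i \<le> k" for i using path_states[OF K path that] .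
  then have s: "state_at M \<nu> i = s i" if "i \<le> k" for i
    using K that by (auto simp: state_at_def \<nu> kripke_def)
  have "\<forall>f\<in>model_constraints R k. pholds \<nu> f"
    using path s by (subst model_constraints_iff[OF R]) simp
  moreover have "\<forall>f\<in>loop_constraints M k. pholds \<nu> f"
    using l unfolding loop_constraints_def by (auto simp: \<nu>)
  moreover have "\<forall>f\<in>last_state_constraints \<psi> k. pholds \<nu> f"
    using last unfolding last_state_constraints_def by (auto simp: \<nu>)
  moreover have "\<forall>f\<in>formula_constraints R \<psi> k. pholds \<nu> f"
  proof -
    have "Fm \<phi> i \<in> \<nu> \<longleftrightarrow> pholds \<nu> (unfold_fm R i \<phi>)" if c: "\<phi> \<in> cl \<psi>" and i: "i \<le> k" for \<phi> i
    proof -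
      have "expand (label M) (state_at M \<nu>) (\<lambda>i \<phi>. Fm \<phi> i \<in> \<nu>) i \<phi> \<longleftrightarrow> expand (label M) s H i \<phi>"
        using s[OF i] by (intro expand_cong) (auto simp: \<nu>)
      then show ?thesis
        using pholds_unfold_fm[OF R, of \<nu> i \<phi>] s[OF i] st[OF i] exp[OF c i] by (simp add: \<nu>)
    qed
    then show ?thesis unfolding formula_constraints_def by auto
  qed
  moreover have "\<forall>f\<in>eventuality_constraints \<psi> k. pholds \<nu> f"
  proof -
    have le_pred: "j \<le> i \<longleftrightarrow> j \<le> i - 1 \<or> j = i" if "1 \<le> i" for i j :: nat using that by linarith
    have F: "AuxF \<phi> i \<in> \<nu> \<longleftrightarrow> AuxF \<phi> (i - 1) \<in> \<nu> \<or> l \<le> i \<and> H i \<phi>" if "1 \<le> i" for \<phi> i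
      unfolding \<nu> using le_pred[OF that] order_refl[of i] by blast
    have G: "AuxG \<phi> i \<in> \<nu> \<longleftrightarrow> AuxG \<phi> (i - 1) \<in> \<nu> \<and> (\<not> l \<le> i \<or> H i \<phi>)" if "1 \<le> i" for \<phi> i
      unfolding \<nu> using le_pred[OF that] order_refl[of i] by blast
    have "\<forall>h\<in>until_constraints f g k. pholds \<nu> h" if "Until f g \<in> cl \<psi>" for f g
    proof -
      have "\<not> AuxF g 0 \<in> \<nu>" using l by (auto simp: \<nu>)
      moreover have "l \<le> k \<Longrightarrow> H k (Until f g) \<Longrightarrow> AuxF g k \<in> \<nu>"
        using evU[OF _ that] by (simp add: \<nu>)
      ultimately show ?thesis using F unfolding until_constraints_def by (auto simp: \<nu>(3-5))
    qed
    moreover have "\<forall>h\<in>release_constraints f g k. pholds \<nu> h" if "Release f g \<in> cl \<psi>" for f g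
    proof -
      have "AuxG g 0 \<in> \<nu>" using l by (auto simp: \<nu>)
      moreover have "l \<le> k \<Longrightarrow> AuxG g k \<in> \<nu> \<Longrightarrow> H k (Release f g)"
        using evR[OF _ that] by (simp add: \<nu>)
      ultimately show ?thesis using G unfolding release_constraints_def by (auto simp: \<nu>(3-5))
    qed
    ultimately show ?thesis unfolding eventuality_constraints_def by blast
  qed
  ultimately show ?thesis
    unfolding satisfiable_def encoding_def using H0 by (intro exI[of _ \<nu>]) (auto simp: \<nu>)
qed

lemma satisfiable_tableau:
  assumes K: "kripke M" and R: "represents R M" and S: "satisfiable (encoding M R \<psi> k)"
  shows "\<exists>l s H. tableau M \<psi> k l s H"
proof -
  obtain \<nu> where \<nu>: "\<And>f. f \<in> encoding M R \<psi> k \<Longrightarrow> pholds \<nu> f"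
    using S unfolding satisfiable_def by blast
  define s where "s = state_at M \<nu>"
  define H where "H i \<phi> \<longleftrightarrow> Fm \<phi> i \<in> \<nu>" for i \<phi>
  have path: "s 0 \<in> initial M" "\<forall>i<k. (s i, s (Suc i)) \<in> transitions M"
    using model_constraints_iff[OF R, of k \<nu>] \<nu> unfolding s_def encoding_def by auto
  have lc: "pholds \<nu> f" if "f \<in> loop_constraints M k" for f
    using \<nu>[of f] that by (simp add: encoding_def)
  have loop0: "InLoop 0 \<notin> \<nu>" "LoopExists \<in> \<nu> \<longleftrightarrow> InLoop k \<in> \<nu>"
    using lc[of "PIff (Atom (InLoop 0)) PFalse"]
      lc[of "PIff (Atom LoopExists) (Atom (InLoop k))"]
    by (auto simp: loop_constraints_def)
  have loop_eq: "Copy v (i - 1) \<in> \<nu> \<longleftrightarrow> Copy v k \<in> \<nu>"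
    if "Lsel i \<in> \<nu>" "1 \<le> i" "i \<le> k" "v \<in> vars M" for i v
    using lc[of "PImp (Atom (Lsel i)) (PIff (Atom (Copy v (i - 1))) (Atom (Copy v k)))"] that
    by (auto simp: loop_constraints_def)
  have inloop: "InLoop i \<in> \<nu> \<longleftrightarrow> InLoop (i - 1) \<in> \<nu> \<or> Lsel i \<in> \<nu>" if "1 \<le> i" "i \<le> k" for i
    using lc[of "PIff (Atom (InLoop i)) (POr (Atom (InLoop (i - 1))) (Atom (Lsel i)))"] that
    by (auto simp: loop_constraints_def)
  have last: "LoopExists \<notin> \<nu> \<Longrightarrow> \<not> H (Suc k) \<phi>"
      "1 \<le> i \<Longrightarrow> i \<le> k \<Longrightarrow> Lsel i \<in> \<nu> \<Longrightarrow> H (Suc k) \<phi> \<longleftrightarrow> H i \<phi>"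
    if "\<phi> \<in> cl \<psi>" for \<phi> i
    using \<nu>[of "PImp (PNot (Atom LoopExists)) (PIff (Atom (Fm \<phi> (k + 1))) PFalse)"]
      \<nu>[of "PImp (Atom (Lsel i)) (PIff (Atom (Fm \<phi> (k + 1))) (Atom (Fm \<phi> i)))"] that
    by (auto simp: encoding_def last_state_constraints_def H_def)
  have exp: "H i \<phi> \<longleftrightarrow> expand (label M) s H i \<phi>" if "\<phi> \<in> cl \<psi>" "i \<le> k" for \<phi> i
  proof -
    have "PIff (Atom (Fm \<phi> i)) (unfold_fm R i \<phi>) \<in> encoding M R \<psi> k"
      using that by (auto simp: encoding_def formula_constraints_def)
    then have "H i \<phi> \<longleftrightarrow> pholds \<nu> (unfold_fm R i \<phi>)" using \<nu> by (fastforce simp: H_def)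
    also have "\<dots> \<longleftrightarrow> expand (label M) s H i \<phi>"
      using pholds_unfold_fm[OF R, of \<nu> i \<phi>] path_states[OF K path that(2)]
      unfolding s_def H_def by blast
    finally show ?thesis .
  qed
  have H0: "H 0 \<psi>" using \<nu>[of "Atom (Fm \<psi> 0)"] by (simp add: encoding_def H_def)
  show ?thesis
  proof (cases "LoopExists \<in> \<nu>")
    case False
    have "tableau M \<psi> k (Suc k) s H"
      using path exp H0 last False unfolding tableau_def by simp
    then show ?thesis by blast
  next
    case True
    have "\<exists>l. 1 \<le> l \<and> l \<le> k \<and> Lsel l \<in> \<nu> \<and> (\<forall>i<l. InLoop i \<notin> \<nu>)"
    proof -
      have k: "InLoop k \<in> \<nu>" using True loop0(2) by simp
      \<comment> \<open>The first position with \<open>InLoop\<close> is the loop start: its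
        predecessor is not in the loop, so its own selector must be true.\<close>
      then obtain l where l: "InLoop l \<in> \<nu>" and below: "\<forall>i<l. InLoop i \<notin> \<nu>"
        using exists_least_iff[of "\<lambda>i. InLoop i \<in> \<nu>"] by blast
      have le: "l \<le> k" using k below not_le by blast
      have pos: "1 \<le> l" using l loop0(1) by (metis less_one not_le)
      then have "InLoop (l - 1) \<notin> \<nu>" using below[rule_format, of "l - 1"] by simp
      then have "Lsel l \<in> \<nu>" using inloop[OF pos le] l by blast
      then show ?thesis using pos le below by blast
    qed
    then obtain l where l: "1 \<le> l" "l \<le> k" "Lsel l \<in> \<nu>" "\<And>i. i < l \<Longrightarrow> InLoop i \<notin> \<nu>" by blast
    have evU: "\<exists>j. l \<le> j \<and> j \<le> k \<and> H j g"
      if c: "Until f g \<in> cl \<psi>" and h: "H k (Until f g)" for f g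
    proof -
      have uc: "pholds \<nu> \<phi>" if "\<phi> \<in> until_constraints f g k" for \<phi>
        using \<nu>[of \<phi>] that c unfolding encoding_def eventuality_constraints_def by blast
      \<comment> \<open>A true \<open>AuxF\<close> must originate at a position with
        \<open>InLoop\<close> and \<open>g\<close>; by minimality of \<open>l\<close> that position
        is at least \<open>l\<close>.\<close>
      have "AuxF g i \<in> \<nu> \<Longrightarrow> i \<le> k \<Longrightarrow> \<exists>j. l \<le> j \<and> j \<le> i \<and> H j g" for i
      proof (induction i)
        case 0
        then show ?case
          using uc[of "PIff (Atom (AuxF g 0)) PFalse"] by (simp add: until_constraints_def)
      next
        case (Suc i)
        have "PIff (Atom (AuxF g (Suc i))) (POr (Atom (AuxF g i))
            (PAnd (Atom (InLoop (Suc i))) (Atom (Fm g (Suc i))))) \<in> until_constraints f g k"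
          using Suc.prems unfolding until_constraints_def by (auto intro!: exI[of _ "Suc i"])
        from uc[OF this] Suc.prems have "AuxF g i \<in> \<nu> \<or> InLoop (Suc i) \<in> \<nu> \<and> H (Suc i) g"
          by (simp add: H_def)
        then show ?case
        proof
          assume "AuxF g i \<in> \<nu>"
          then show ?thesis using Suc by (meson Suc_leD le_SucI)
        next
          assume a: "InLoop (Suc i) \<in> \<nu> \<and> H (Suc i) g"
          then have "l \<le> Suc i" using l(4) by (meson not_le)
          then show ?thesis using a by blast
        qed
      qed
      moreover have "AuxF g k \<in> \<nu>"
        using uc[of "PImp (Atom LoopExists) (PImp (Atom (Fm (Until f g) k)) (Atom (AuxF g k)))"]
          True h by (simp add: until_constraints_def H_def)
      ultimately show ?thesis by blast
    qed
    have evR: "H k (Release f g)"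
      if c: "Release f g \<in> cl \<psi>" and h: "\<forall>j. l \<le> j \<and> j \<le> k \<longrightarrow> H j g" for f g
    proof -
      have rc: "pholds \<nu> \<phi>" if "\<phi> \<in> release_constraints f g k" for \<phi>
        using \<nu>[of \<phi>] that c unfolding encoding_def eventuality_constraints_def by blast
      \<comment> \<open>\<open>AuxG\<close> is never switched off: positions before \<open>l\<close>
        are outside the loop, and from \<open>l\<close> on \<open>g\<close> is marked.\<close>
      have "i \<le> k \<Longrightarrow> AuxG g i \<in> \<nu>" for i
      proof (induction i)
        case 0
        then show ?case
          using rc[of "PIff (Atom (AuxG g 0)) PTrue"] by (simp add: release_constraints_def)
      next
        case (Suc i)
        have "PIff (Atom (AuxG g (Suc i))) (PAnd (Atom (AuxG g i))
            (POr (PNot (Atom (InLoop (Suc i)))) (Atom (Fm g (Suc i))))) \<in> release_constraints f g k"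
          using Suc.prems unfolding release_constraints_def by (auto intro!: exI[of _ "Suc i"])
        from rc[OF this] Suc have
          "AuxG g (Suc i) \<in> \<nu> \<longleftrightarrow> InLoop (Suc i) \<notin> \<nu> \<or> H (Suc i) g"
          by (simp add: H_def)
        then show ?case using h Suc.prems l(4)[of "Suc i"] by (meson not_le)
      qed
      then show ?thesis
        using rc[of "PImp (Atom LoopExists) (PImp (Atom (AuxG g k)) (Atom (Fm (Release f g) k)))"]
          True by (simp add: release_constraints_def H_def)
    qed
    have "s (l - 1) = s k" using loop_eq[OF l(3,1,2)] by (auto simp: s_def state_at_def)
    then have "tableau M \<psi> k l s H"
      using path exp H0 last(2) l evU evR unfolding tableau_def by auto
    then show ?thesis by blast
  qed
qed

theorem theorem3p2:
  fixes M :: "('v, 'a) kripke" and R :: "('v, 'a) symbolic" and \<psi> :: "'a ltl"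
  assumes "kripke M" and "represents R M"
  shows "((\<exists>\<pi>. initialised_path M \<pi> \<and> sat (label M) \<pi> 0 \<psi>) \<longleftrightarrow>
            (\<exists>k. satisfiable (encoding M R \<psi> k))) \<and>
         (\<forall>\<pi> k. initialised_path M \<pi> \<and> bounded_sat (label M) \<pi> k \<psi> \<longrightarrow>
            satisfiable (encoding M R \<psi> k))"
proof (intro conjI iffI allI impI)
  assume "\<exists>\<pi>. initialised_path M \<pi> \<and> sat (label M) \<pi> 0 \<psi>"
  then show "\<exists>k. satisfiable (encoding M R \<psi> k)"
    using tableau_exists[OF assms(1)] tableau_satisfiable[OF assms] by blast
next
  assume "\<exists>k. satisfiable (encoding M R \<psi> k)"
  then show "\<exists>\<pi>. initialised_path M \<pi> \<and> sat (label M) \<pi> 0 \<psi>"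
    using satisfiable_tableau[OF assms] tableau_sound[OF assms(1)] by blast
next
  fix \<pi> k assume "initialised_path M \<pi> \<and> bounded_sat (label M) \<pi> k \<psi>"
  then show "satisfiable (encoding M R \<psi> k)"
    using tableau_bounded_sat tableau_satisfiable[OF assms] by blast
qed

end
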